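(* For arbitrary $m\ge 2$, a gadget can be constructed for every forbidden set $\mathcal H\subset\{0,1\}^m$, where $\mathcal H$ ranges over the $2^{2^m}-1$ subsets of $\{0,1\}^m$ other than the empty set.
   Context: The orthogonality graph of a set of vectors in $\mathbb C^d$ has the vectors as vertices, two vertices being adjacent if and only if the vectors are orthogonal. For a finite simple graph $G$ with clique number $\omega(G)$, a $\{0,1\}$-coloring of $G$ is a map $f:V_G\to\{0,1\}$ such that (i) $\sum_{v\in C}f(v)\le 1$ for every clique $C$ of $G$, and (ii) every clique of size $\omega(G)$ contains exactly one vertex $v$ with $f(v)=1$. A $\{0,1\}$-coloring of a set of vectors is a $\{0,1\}$-coloring of its orthogonality graph. A $\{0,1\}$-colorable set $\mathcal S\subset\mathbb C^d$ is a gadget in dimension $d$ for a specified forbidden set $\mathcal H\subset\{0,1\}^m$ if it contains an ordered set of mutually non-orthogonal vectors $I=\{|v_1\rangle,\dots,|v_m\rangle\}$ such that every $\{0,1\}$-coloring $f$ of $\mathcal S$ satisfies $f(I)\in\{0,1\}^m\setminus\mathcal H$. Equivalently, in graph terms: a $\{0,1\}$-colorable graph $G$ with $d^*(G)=\omega(G)=d$ containing an ordered independent set $I$ of cardinality $m$ such that every $\{0,1\}$-coloring $f$ of $G$ satisfies $f(I)\in\{0,1\}^m\setminus\mathcal H$. Here $d^*(G)$ is the minimal dimension of a faithful orthogonal representation of $G$, i.e. an assignment of pairwise non-parallel unit vectors to the vertices such that two vectors are orthogonal if and only if the vertices are adjacent. The case $\mathcal H=\{0,1\}^m$ is included in the count: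 Kochen–Specker sets (sets of vectors admitting no $\{0,1\}$-coloring) are regarded as the generalised gadget structures for $\mathcal H=\{0,1\}^m$. The claim does not specify the dimension $d$. *)

theory Defs
  imports Complex_Main "HOL-Library.FuncSet" "Jordan_Normal_Form.Matrix"
    "Jordan_Normal_Form.Determinant"
begin

section \<open>Finite simple graphs and {0,1}-colorings\<close>

text \<open>A graph is given by its vertex set \<open>V\<close> and its set \<open>E\<close> of two-element edges.\<close>

definition finite_simple_graph :: "'a set \<Rightarrow> 'a set set \<Rightarrow> bool" where
  "finite_simple_graph V E \<longleftrightarrow> finite V \<and> (\<forall>e\<in>E. e \<subseteq> V \<and> card e = 2)"

definition clique :: "'a set \<Rightarrow> 'a set set \<Rightarrow> 'a set \<Rightarrow> bool" where
  "clique V E C \<longleftrightarrow> C \<subseteq> V \<and> (\<forall>u\<in>C. \<forall>v\<in>C. u \<noteq> v \<longrightarrow> {u, v} \<in> E)"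

definition clique_number :: "'a set \<Rightarrow> 'a set set \<Rightarrow> nat" where
  "clique_number V E = Max {card C | C. clique V E C}"

definition zero_one_coloring :: "'a set \<Rightarrow> 'a set set \<Rightarrow> ('a \<Rightarrow> nat) \<Rightarrow> bool" where
  "zero_one_coloring V E f \<longleftrightarrow>
     f \<in> V \<rightarrow> {0, 1} \<and>
     (\<forall>C. clique V E C \<longrightarrow> (\<Sum>v\<in>C. f v) \<le> 1) \<and>
     (\<forall>C. clique V E C \<and> card C = clique_number V E \<longrightarrow> (\<exists>!v. v \<in> C \<and> f v = 1))"

definition zero_one_colorable :: "'a set \<Rightarrow> 'a set set \<Rightarrow> bool" where
  "zero_one_colorable V E \<longleftrightarrow> (\<exists>f. zero_one_coloring V E f)"

definition bit_strings :: "nat \<Rightarrow> nat list set" where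
  "bit_strings m = {b. length b = m \<and> set b \<subseteq> {0, 1}}"


section \<open>Sets of vectors\<close>

definition unit_vector :: "complex vec \<Rightarrow> bool" where
  "unit_vector u \<longleftrightarrow> u \<bullet>c u = 1"

definition parallel :: "complex vec \<Rightarrow> complex vec \<Rightarrow> bool" where
  "parallel u v \<longleftrightarrow> (\<exists>c. u = c \<cdot>\<^sub>v v)"

definition orthogonality_edges :: "complex vec set \<Rightarrow> complex vec set set" where
  "orthogonality_edges S = {{u, v} | u v. u \<in> S \<and> v \<in> S \<and> u \<noteq> v \<and> u \<bullet>c v = 0}"

text \<open>
  The vectors are rays, represented by pairwise non-parallel unit vectors.  The last conjunct is
  the convention \<open>\<omega>(G) = d\<close> for the orthogonality graph; without it a condition on maximum
  cliques says nothing about orthonormal bases (the orthogonality graph of a pentagram in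
  three dimensions has no triangle, and would be a Kochen--Specker set).  The condition \<open>d > 0\<close>
  excludes the empty set in dimension 0, whose empty maximum clique contains no vertex of color 1.
\<close>

definition vector_set :: "nat \<Rightarrow> complex vec set \<Rightarrow> bool" where
  "vector_set d S \<longleftrightarrow>
     d > 0 \<and> finite S \<and> S \<subseteq> carrier_vec d \<and>
     (\<forall>u\<in>S. unit_vector u) \<and>
     (\<forall>u\<in>S. \<forall>v\<in>S. u \<noteq> v \<longrightarrow> \<not> parallel u v) \<and>
     clique_number S (orthogonality_edges S) = d"

definition KS_set :: "nat \<Rightarrow> complex vec set \<Rightarrow> bool" where
  "KS_set d S \<longleftrightarrow> vector_set d S \<and> \<not> zero_one_colorable S (orthogonality_edges S)"

text \<open>The ordered set \<open>I\<close> is a list without repetitions, and \<open>f(I)\<close> is \<open>map f I\<close>.\<close>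

definition gadget :: "nat \<Rightarrow> nat \<Rightarrow> nat list set \<Rightarrow> complex vec set \<Rightarrow> bool" where
  "gadget d m H S \<longleftrightarrow>
     vector_set d S \<and> zero_one_colorable S (orthogonality_edges S) \<and>
     (\<exists>I. length I = m \<and> distinct I \<and> set I \<subseteq> S \<and>
        (\<forall>u\<in>set I. \<forall>v\<in>set I. u \<noteq> v \<longrightarrow> u \<bullet>c v \<noteq> 0) \<and>
        (\<forall>f. zero_one_coloring S (orthogonality_edges S) f \<longrightarrow> map f I \<in> bit_strings m - H))"

text \<open>
  No colorable set satisfies the definition of a gadget for \<open>H = {0,1}\<^sup>m\<close>; by convention,
  the structures for this forbidden set are the Kochen--Specker sets.
\<close>

definition generalised_gadget :: "nat \<Rightarrow> nat \<Rightarrow> nat list set \<Rightarrow> complex vec set \<Rightarrow> bool" where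
  "generalised_gadget d m H S \<longleftrightarrow>
     (if H = bit_strings m then KS_set d S else gadget d m H S)"


section \<open>Agreement with the graph-theoretic form\<close>

definition faithful_orthogonal_rep ::
    "nat \<Rightarrow> 'a set \<Rightarrow> 'a set set \<Rightarrow> ('a \<Rightarrow> complex vec) \<Rightarrow> bool" where
  "faithful_orthogonal_rep n V E \<phi> \<longleftrightarrow>
     \<phi> \<in> V \<rightarrow> carrier_vec n \<and>
     (\<forall>v\<in>V. unit_vector (\<phi> v)) \<and>
     (\<forall>u\<in>V. \<forall>v\<in>V. u \<noteq> v \<longrightarrow> \<not> parallel (\<phi> u) (\<phi> v)) \<and>
     (\<forall>u\<in>V. \<forall>v\<in>V. u \<noteq> v \<longrightarrow> (\<phi> u \<bullet>c \<phi> v = 0 \<longleftrightarrow> {u, v} \<in> E))"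

definition min_faithful_dim :: "'a set \<Rightarrow> 'a set set \<Rightarrow> nat" where
  "min_faithful_dim V E = (LEAST n. \<exists>\<phi>. faithful_orthogonal_rep n V E \<phi>)"

definition graph_gadget :: "nat \<Rightarrow> nat \<Rightarrow> nat list set \<Rightarrow> 'a set \<Rightarrow> 'a set set \<Rightarrow> bool" where
  "graph_gadget d m H V E \<longleftrightarrow>
     finite_simple_graph V E \<and> zero_one_colorable V E \<and>
     min_faithful_dim V E = d \<and> clique_number V E = d \<and>
     (\<exists>I. length I = m \<and> distinct I \<and> set I \<subseteq> V \<and>
        (\<forall>u\<in>set I. \<forall>v\<in>set I. {u, v} \<notin> E) \<and>
        (\<forall>f. zero_one_coloring V E f \<longrightarrow> map f I \<in> bit_strings m - H))"

lemma orthonormal_card_le: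
  fixes w :: "nat \<Rightarrow> complex vec"
  assumes car: "\<And>i. i < k \<Longrightarrow> w i \<in> carrier_vec n"
    and on: "\<And>i j. i < k \<Longrightarrow> j < k \<Longrightarrow> w i \<bullet>c w j = (if i = j then 1 else 0)"
  shows "k \<le> n"
proof (rule ccontr)
  assume "\<not> k \<le> n"
  hence nk: "n < k" by simp
  define A where "A = mat k k (\<lambda>(i, j). if j < n then w i $ j else 0)"
  define B where "B = mat k k (\<lambda>(j, l). if j < n then cnj (w l $ j) else 0)"
  have AB: "A * B = 1\<^sub>m k"
  proof (rule eq_matI)
    fix i l assume "i < dim_row (1\<^sub>m k :: complex mat)" "l < dim_col (1\<^sub>m k :: complex mat)"
    hence il: "i < k" "l < k" by auto
    have "(A * B) $$ (i, l) =
        (\<Sum>j\<in>{0..<k}. (if j < n then w i $ j else 0) * (if j < n then cnj (w l $ j) else 0))"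
      using il by (simp add: A_def B_def scalar_prod_def)
    also have "\<dots> = (\<Sum>j\<in>{0..<n}. w i $ j * cnj (w l $ j))"
      using nk by (intro sum.mono_neutral_cong_right) auto
    also have "\<dots> = w i \<bullet>c w l"
      using car[OF il(1)] car[OF il(2)] by (simp add: scalar_prod_def)
    finally show "(A * B) $$ (i, l) = 1\<^sub>m k $$ (i, l)"
      using on[OF il] il by simp
  qed (auto simp: A_def B_def)
  have "B * A = 1\<^sub>m k"
    by (rule mat_mult_left_right_inverse[OF _ _ AB]) (auto simp: A_def B_def)
  moreover have "(B * A) $$ (n, n) = 0"
    using nk by (simp add: A_def B_def scalar_prod_def)
  ultimately show False using nk by simp
qed

lemma clique_card_le_rep_dim:
  assumes "faithful_orthogonal_rep n V E \<phi>" "clique V E C" "finite C"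
  shows "card C \<le> n"
proof -
  obtain h where h: "bij_betw h {0..<card C} C"
    using ex_bij_betw_nat_finite[OF assms(3)] by blast
  have hC: "h i \<in> C" if "i < card C" for i
    using h that by (auto simp: bij_betw_def)
  have hinj: "h i = h j \<longleftrightarrow> i = j" if "i < card C" "j < card C" for i j
    using h that by (auto simp: bij_betw_def inj_on_def)
  have CV: "C \<subseteq> V" using assms(2) by (auto simp: clique_def)
  show ?thesis
  proof (rule orthonormal_card_le[of _ "\<lambda>i. \<phi> (h i)"])
    fix i assume "i < card C"
    thus "\<phi> (h i) \<in> carrier_vec n"
      using hC CV assms(1) by (auto simp: faithful_orthogonal_rep_def)
  next
    fix i j assume ij: "i < card C" "j < card C"
    have V: "h i \<in> V" "h j \<in> V" using hC CV ij by auto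
    show "\<phi> (h i) \<bullet>c \<phi> (h j) = (if i = j then 1 else 0)"
    proof (cases "i = j")
      case True
      thus ?thesis using assms(1) V
        by (simp add: faithful_orthogonal_rep_def unit_vector_def)
    next
      case False
      hence "{h i, h j} \<in> E" using assms(2) hC ij hinj by (simp add: clique_def)
      thus ?thesis using assms(1) V False hinj ij
        by (simp add: faithful_orthogonal_rep_def)
    qed
  qed
qed

lemma orthogonality_edges_iff:
  assumes "vector_set d S" "u \<in> S" "v \<in> S"
  shows "{u, v} \<in> orthogonality_edges S \<longleftrightarrow> u \<noteq> v \<and> u \<bullet>c v = 0"
proof -
  have "u \<in> carrier_vec d" "v \<in> carrier_vec d"
    using assms by (auto simp: vector_set_def)
  hence "v \<bullet>c u = cnj (u \<bullet>c v)"
    by (auto simp: scalar_prod_def mult.commute)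
  hence "v \<bullet>c u = 0 \<longleftrightarrow> u \<bullet>c v = 0" by simp
  thus ?thesis using assms(2,3)
    by (auto simp: orthogonality_edges_def doubleton_eq_iff)
qed

lemma min_faithful_dim_vector_set:
  assumes S: "vector_set d S"
  shows "min_faithful_dim S (orthogonality_edges S) = d"
  unfolding min_faithful_dim_def
proof (rule Least_equality)
  have "faithful_orthogonal_rep d S (orthogonality_edges S) id"
    using S orthogonality_edges_iff[OF S]
    by (auto simp: faithful_orthogonal_rep_def vector_set_def)
  thus "\<exists>\<phi>. faithful_orthogonal_rep d S (orthogonality_edges S) \<phi>" by blast
next
  fix n assume "\<exists>\<phi>. faithful_orthogonal_rep n S (orthogonality_edges S) \<phi>"
  then obtain \<phi> where \<phi>: "faithful_orthogonal_rep n S (orthogonality_edges S) \<phi>" by blast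
  let ?K = "{card C | C. clique S (orthogonality_edges S) C}"
  have finS: "finite S" using S by (simp add: vector_set_def)
  have "?K \<subseteq> card ` Pow S" by (auto simp: clique_def)
  hence "finite ?K" using finS by (meson finite_Pow_iff finite_imageI finite_subset)
  moreover have "clique S (orthogonality_edges S) {}" by (simp add: clique_def)
  hence "?K \<noteq> {}" by blast
  ultimately have "Max ?K \<in> ?K" by (rule Max_in)
  moreover have "Max ?K = d" using S by (simp add: vector_set_def clique_number_def)
  ultimately obtain C where C: "clique S (orthogonality_edges S) C" "card C = d" by auto
  have "finite C" using C(1) finS by (auto simp: clique_def intro: finite_subset)
  thus "d \<le> n" using clique_card_le_rep_dim[OF \<phi> C(1)] C(2) by simp
qed

lemma gadget_imp_graph_gadget:
  assumes "gadget d m H S"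
  shows "graph_gadget d m H S (orthogonality_edges S)"
proof -
  have S: "vector_set d S" using assms by (simp add: gadget_def)
  have "finite_simple_graph S (orthogonality_edges S)"
    using S by (auto simp: finite_simple_graph_def orthogonality_edges_def vector_set_def)
  moreover from assms obtain I where I: "length I = m" "distinct I" "set I \<subseteq> S"
    "\<forall>u\<in>set I. \<forall>v\<in>set I. u \<noteq> v \<longrightarrow> u \<bullet>c v \<noteq> 0"
    "\<forall>f. zero_one_coloring S (orthogonality_edges S) f \<longrightarrow> map f I \<in> bit_strings m - H"
    unfolding gadget_def by blast
  moreover have "\<forall>u\<in>set I. \<forall>v\<in>set I. {u, v} \<notin> orthogonality_edges S"
    using I(3,4) orthogonality_edges_iff[OF S] by blast
  ultimately show ?thesis
    using assms S min_faithful_dim_vector_set[OF S]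
    unfolding graph_gadget_def gadget_def vector_set_def by blast
qed

end

(* The 18-vector Kochen-Specker set K of C^4, placed in the hyperplane of C^5 orthogonal to a vector
   v (the pole), forces the colour 1 on v and the colour 0 on everything orthogonal to v.  Let P be
   a coordinate plane meeting the hyperplane in the last axis of C^4, and rotate v together with
   its copy of K inside P through several angles.  Inner products of integer vectors are integers,
   whereas the cosine of the difference of two angles is not, so vectors of different copies are
   orthogonal only if one of them already lies in both hyperplanes.  Hence an orthonormal basis
   contains exactly one pole, colouring exactly the poles by 1 is admissible, and a forbidden set
   omitting a string b is realised by forcing f(I) = b: a pole for each 1, and for each 0 a vector
   orthogonal to one further pole.  Two poles at a right angle give a Kochen-Specker set. *)

theory Submission
  imports Defs
begin

section \<open>Rays\<close>

text \<open>The choice depends only on the line spanned by \<open>x\<close>, so images under \<open>ray\<close> contain no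
  two parallel vectors.\<close>

definition ray :: "complex vec \<Rightarrow> complex vec" where
  "ray x = (SOME u. unit_vector u \<and> parallel u x)"

lemma cscalar_prod_smult:
  assumes "x \<in> carrier_vec n" "y \<in> carrier_vec n"
  shows "(c \<cdot>\<^sub>v x) \<bullet>c (k \<cdot>\<^sub>v y) = c * cnj k * (x \<bullet>c y)"
  using assms by (simp add: conjugate_smult_vec)

lemma cscalar_prod_swap:
  fixes x y :: "complex vec"
  assumes "x \<in> carrier_vec n" "y \<in> carrier_vec n"
  shows "y \<bullet>c x = cnj (x \<bullet>c y)"
  using assms by (auto simp: scalar_prod_def mult.commute)

lemma ray_smultE:
  assumes "x \<in> carrier_vec n" "x \<noteq> 0\<^sub>v n"
  obtains c where "c \<noteq> 0" "ray x = c \<cdot>\<^sub>v x" "unit_vector (ray x)"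
proof -
  have "x \<bullet>c x > 0" using conjugate_square_greater_0_vec[OF assms(1)] assms(2) by simp
  \<comment> \<open>Positivity in the order on the complex numbers includes being real, so
    \<open>x \<bullet>c x\<close> has a real square root to normalise by.\<close>
  then obtain r where r: "x \<bullet>c x = of_real r" "r > 0"
    by (intro that[of "Re (x \<bullet>c x)"]) (auto simp: less_complex_def complex_eq_iff)
  have "unit_vector (complex_of_real (1 / sqrt r) \<cdot>\<^sub>v x)"
    using r unfolding unit_vector_def cscalar_prod_smult[OF assms(1,1)]
    by (simp flip: of_real_mult of_real_divide)
  hence "\<exists>u. unit_vector u \<and> parallel u x" by (auto simp: parallel_def)
  hence *: "unit_vector (ray x) \<and> parallel (ray x) x" unfolding ray_def by (rule someI_ex)
  then obtain c where c: "ray x = c \<cdot>\<^sub>v x" by (auto simp: parallel_def)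
  have "c \<noteq> 0"
  proof
    assume "c = 0"
    hence "ray x \<bullet>c ray x = 0" using c cscalar_prod_smult[OF assms(1,1), of c c] by simp
    thus False using * by (simp add: unit_vector_def)
  qed
  thus ?thesis using that c * by blast
qed

lemma unit_vector_ray:
  assumes "x \<in> carrier_vec n" "x \<noteq> 0\<^sub>v n"
  shows "unit_vector (ray x)"
  using ray_smultE[OF assms] by blast

lemma ray_carrier:
  assumes "x \<in> carrier_vec n" "x \<noteq> 0\<^sub>v n"
  shows "ray x \<in> carrier_vec n"
  using ray_smultE[OF assms] assms(1) by (metis smult_carrier_vec)

lemma ray_orthogonal_iff:
  assumes "x \<in> carrier_vec n" "x \<noteq> 0\<^sub>v n" "y \<in> carrier_vec n" "y \<noteq> 0\<^sub>v n"
  shows "ray x \<bullet>c ray y = 0 \<longleftrightarrow> x \<bullet>c y = 0"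
  by (rule ray_smultE[OF assms(1,2)], rule ray_smultE[OF assms(3,4)])
    (simp add: cscalar_prod_smult[OF assms(1,3)])

lemma ray_eqI:
  assumes "x = c \<cdot>\<^sub>v y" "c \<noteq> 0"
  shows "ray x = ray y"
proof -
  have y: "y = (1 / c) \<cdot>\<^sub>v x" using assms by (simp add: smult_smult_assoc)
  have "parallel u x \<longleftrightarrow> parallel u y" for u
    unfolding parallel_def using y assms(1) by (metis smult_smult_assoc)
  thus ?thesis by (simp add: ray_def)
qed

text \<open>The scalar relating \<open>x\<close> and \<open>y\<close> cannot vanish because
  \<open>x\<close> is nonzero, so both span the same line and the choice made by \<open>ray\<close>
  agrees.\<close>

lemma parallel_rayD:
  assumes "x \<in> carrier_vec n" "x \<noteq> 0\<^sub>v n" "y \<in> carrier_vec n" "y \<noteq> 0\<^sub>v n"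
    and "parallel (ray x) (ray y)"
  shows "ray x = ray y"
proof -
  obtain a where a: "a \<noteq> 0" "ray x = a \<cdot>\<^sub>v x" using ray_smultE[OF assms(1,2)] by blast
  obtain b where b: "b \<noteq> 0" "ray y = b \<cdot>\<^sub>v y" using ray_smultE[OF assms(3,4)] by blast
  obtain c where "ray x = c \<cdot>\<^sub>v ray y" using assms(5) by (auto simp: parallel_def)
  hence "a \<cdot>\<^sub>v x = (c * b) \<cdot>\<^sub>v y" using a b by (simp add: smult_smult_assoc)
  hence "(1 / a) \<cdot>\<^sub>v (a \<cdot>\<^sub>v x) = (1 / a) \<cdot>\<^sub>v ((c * b) \<cdot>\<^sub>v y)" by simp
  hence x: "x = (c * b / a) \<cdot>\<^sub>v y" using a(1) by (simp add: smult_smult_assoc)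
  have "c * b / a \<noteq> 0"
  proof
    assume "c * b / a = 0"
    hence "x = 0\<^sub>v n" using x assms(3) by auto
    thus False using assms(2) by simp
  qed
  thus ?thesis using x ray_eqI by blast
qed

text \<open>Proportional vectors have vanishing 2x2 minors; in contrapositive form this tells two
  rays apart by their coordinates.\<close>

lemma ray_eqD:
  assumes "x \<in> carrier_vec n" "x \<noteq> 0\<^sub>v n" "y \<in> carrier_vec n" "y \<noteq> 0\<^sub>v n"
    and "ray x = ray y" "i < n" "j < n"
  shows "x $ i * y $ j = x $ j * y $ i"
proof -
  obtain a where a: "a \<noteq> 0" "ray x = a \<cdot>\<^sub>v x" using ray_smultE[OF assms(1,2)] by blast
  obtain b where b: "b \<noteq> 0" "ray y = b \<cdot>\<^sub>v y" using ray_smultE[OF assms(3,4)] by blast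
  have eq: "a * x $ k = b * y $ k" if "k < n" for k
    using arg_cong[OF assms(5), of "\<lambda>v. v $ k"] a b assms(1,3) that by simp
  have "a * b * (x $ i * y $ j) = (a * x $ i) * (b * y $ j)" by simp
  also have "\<dots> = (b * y $ i) * (a * x $ j)" using eq[OF assms(6)] eq[OF assms(7)] by simp
  finally show ?thesis using a b by (simp add: mult.assoc mult.left_commute)
qed

lemma clique_orthogonality_edges:
  assumes "S \<subseteq> carrier_vec n"
  shows "clique S (orthogonality_edges S) C \<longleftrightarrow>
    C \<subseteq> S \<and> (\<forall>u\<in>C. \<forall>v\<in>C. u \<noteq> v \<longrightarrow> u \<bullet>c v = 0)"
proof -
  have "{u, v} \<in> orthogonality_edges S \<longleftrightarrow> u \<noteq> v \<and> u \<bullet>c v = 0" if "u \<in> S" "v \<in> S" for u v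
  proof -
    have "v \<bullet>c u = cnj (u \<bullet>c v)" using cscalar_prod_swap that assms by blast
    thus ?thesis using that by (auto simp: orthogonality_edges_def doubleton_eq_iff)
  qed
  thus ?thesis unfolding clique_def by blast
qed

section \<open>Cliques and colourings of a finite set of rays\<close>

locale vectors =
  fixes n :: nat and X :: "complex vec set"
  assumes fin: "finite X" and car: "x \<in> X \<Longrightarrow> x \<in> carrier_vec n" and nonzero: "x \<in> X \<Longrightarrow> x \<noteq> 0\<^sub>v n"
begin

text \<open>\<open>X\<close> holds unnormalised representatives. Several of them may span one line
  and then contribute a single ray: \<open>pole (pi / 2)\<close> below is the negative of
  \<open>emb 0 (0, 0, 0, 1)\<close>.\<close>

abbreviation "S \<equiv> ray ` X"
abbreviation "E \<equiv> orthogonality_edges S"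

lemma clique_iff: "clique S E C \<longleftrightarrow> C \<subseteq> S \<and> (\<forall>u\<in>C. \<forall>v\<in>C. u \<noteq> v \<longrightarrow> u \<bullet>c v = 0)"
  by (rule clique_orthogonality_edges[of _ n]) (use ray_carrier car nonzero in blast)

lemma orthogonal_iff: "x \<in> X \<Longrightarrow> y \<in> X \<Longrightarrow> ray x \<bullet>c ray y = 0 \<longleftrightarrow> x \<bullet>c y = 0"
  using ray_orthogonal_iff car nonzero by blast

lemma not_parallel: "u \<in> S \<Longrightarrow> v \<in> S \<Longrightarrow> u \<noteq> v \<Longrightarrow> \<not> parallel u v"
  using parallel_rayD car nonzero by blast

lemma unit: "u \<in> S \<Longrightarrow> u \<in> carrier_vec n \<and> u \<bullet>c u = 1"
  using unit_vector_ray ray_carrier car nonzero unfolding unit_vector_def by blast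

lemma finite_clique: "clique S E C \<Longrightarrow> finite C"
  using fin by (auto simp: clique_def intro: finite_subset)

text \<open>The identity is a faithful orthogonal representation of the rays in dimension
  \<open>n\<close>, so cliques are orthonormal families.\<close>

lemma clique_card_le: "clique S E C \<Longrightarrow> card C \<le> n"
proof (rule clique_card_le_rep_dim[of n S E id])
  have "{u, v} \<in> E \<longleftrightarrow> u \<bullet>c v = 0" if "u \<in> S" "v \<in> S" "u \<noteq> v" for u v
  proof -
    have "u \<bullet>c v = 0 \<longleftrightarrow> v \<bullet>c u = 0" using cscalar_prod_swap[of u n v] unit that by auto
    thus ?thesis using clique_iff[of "{u, v}"] that by (auto simp: clique_def insert_commute)
  qed
  thus "faithful_orthogonal_rep n S E id"
    using unit not_parallel by (auto simp: faithful_orthogonal_rep_def unit_vector_def)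
qed (use finite_clique in auto)

text \<open>A unit vector is not orthogonal to itself, so orthogonal representatives never yield the
  same ray twice.\<close>

lemma orthogonal_list:
  assumes "sorted_wrt (\<lambda>x y. x \<bullet>c y = 0) xs" "set xs \<subseteq> X"
  shows "distinct (map ray xs)" "clique S E (ray ` set xs)"
proof -
  have "distinct (map ray xs) \<and> (\<forall>u\<in>ray ` set xs. \<forall>v\<in>ray ` set xs. u \<noteq> v \<longrightarrow> u \<bullet>c v = 0)"
    using assms
  proof (induction xs)
    case (Cons x xs)
    have *: "ray x \<bullet>c ray y = 0 \<and> ray y \<bullet>c ray x = 0" if "y \<in> set xs" for y
    proof -
      have "ray x \<bullet>c ray y = 0" using Cons.prems that orthogonal_iff by auto
      moreover have "ray y \<bullet>c ray x = cnj (ray x \<bullet>c ray y)"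
        using cscalar_prod_swap unit Cons.prems that by (meson imageI list.set_intros subsetD)
      ultimately show ?thesis by simp
    qed
    have "ray x \<notin> ray ` set xs"
    proof
      assume "ray x \<in> ray ` set xs"
      then obtain y where "y \<in> set xs" "ray x = ray y" by auto
      hence "ray x \<bullet>c ray x = 0" using * by auto
      thus False using unit Cons.prems by auto
    qed
    thus ?case using Cons * by auto
  qed simp
  thus "distinct (map ray xs)" "clique S E (ray ` set xs)"
    unfolding clique_iff using assms(2) by auto
qed

lemma vector_set_rays:
  assumes "sorted_wrt (\<lambda>x y. x \<bullet>c y = 0) xs" "set xs \<subseteq> X" "length xs = n" "n > 0"
  shows "vector_set n S"
proof -
  have "card (ray ` set xs) = n"
    using distinct_card[OF orthogonal_list(1)[OF assms(1,2)]] assms(3) by simp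
  hence "Max {card C | C. clique S E C} = n"
    using clique_card_le orthogonal_list(2)[OF assms(1,2)]
    by (intro Max_eqI) (auto intro: finite_subset[of _ "{..n}"])
  thus ?thesis using assms(4) fin unit not_parallel
    by (auto simp: vector_set_def clique_number_def unit_vector_def)
qed

text \<open>As the rays of an orthogonal list are distinct, list sums are sums over cliques; the
  colouring conditions thus apply directly to explicitly listed bases.\<close>

lemma coloring_orthogonal_list:
  assumes "zero_one_coloring S E f" "sorted_wrt (\<lambda>x y. x \<bullet>c y = 0) xs" "set xs \<subseteq> X"
  shows "(\<Sum>x\<leftarrow>xs. f (ray x)) \<le> 1"
    "vector_set n S \<Longrightarrow> length xs = n \<Longrightarrow> (\<Sum>x\<leftarrow>xs. f (ray x)) = 1"
proof -
  let ?C = "ray ` set xs"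
  note C = orthogonal_list[OF assms(2,3)]
  have sum: "(\<Sum>x\<leftarrow>xs. f (ray x)) = sum f ?C"
    using sum_list_distinct_conv_sum_set[OF C(1), of f] by (simp add: comp_def)
  show le: "(\<Sum>x\<leftarrow>xs. f (ray x)) \<le> 1"
    unfolding sum using assms(1) C(2) by (simp add: zero_one_coloring_def)
  assume "vector_set n S" "length xs = n"
  hence "card ?C = clique_number S E"
    using distinct_card[OF C(1)] by (simp add: vector_set_def)
  then obtain v where "v \<in> ?C" "f v = 1"
    using assms(1) C(2) unfolding zero_one_coloring_def by blast
  hence "1 \<le> sum f ?C" by (metis finite_imageI finite_set member_le_sum zero_le)
  thus "(\<Sum>x\<leftarrow>xs. f (ray x)) = 1" using le sum by simp
qed

end

section \<open>The 18-vector Kochen--Specker set\<close>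

text \<open>Integer coordinates turn orthogonality checks into computations, and integrality later
  rules out orthogonality between different copies.\<close>

type_synonym quad = "int \<times> int \<times> int \<times> int"

fun dot :: "quad \<Rightarrow> quad \<Rightarrow> int" where
  "dot (p, q, r, s) (p', q', r', s') = p * p' + q * q' + r * r' + s * s'"

text \<open>The set of Cabello, Estebaranz and Garcia-Alcaine.\<close>

definition ks_bases :: "quad list list" where
  "ks_bases =
    [[(0,0,0,1), (0,0,1,0), (1,1,0,0), (1,-1,0,0)],
     [(0,0,0,1), (0,1,0,0), (1,0,1,0), (1,0,-1,0)],
     [(1,-1,1,-1), (1,-1,-1,1), (1,1,0,0), (0,0,1,1)],
     [(1,-1,1,-1), (1,1,1,1), (1,0,-1,0), (0,1,0,-1)],
     [(0,0,1,0), (0,1,0,0), (1,0,0,1), (1,0,0,-1)],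
     [(1,-1,-1,1), (1,1,1,1), (1,0,0,-1), (0,1,-1,0)],
     [(1,1,-1,1), (1,1,1,-1), (1,-1,0,0), (0,0,1,1)],
     [(1,1,-1,1), (-1,1,1,1), (1,0,1,0), (0,1,0,-1)],
     [(1,1,1,-1), (-1,1,1,1), (1,0,0,1), (0,1,-1,0)]]"

definition ks_vectors :: "quad set" where
  "ks_vectors = set (concat ks_bases)"

lemma ks_bases_orthogonal:
  assumes "B \<in> set ks_bases"
  shows "sorted_wrt (\<lambda>x y. dot x y = 0) B" "length B = 4"
proof -
  have "\<forall>B\<in>set ks_bases. sorted_wrt (\<lambda>x y. dot x y = 0) B \<and> length B = 4"
    by (simp add: ks_bases_def)
  thus "sorted_wrt (\<lambda>x y. dot x y = 0) B" "length B = 4" using assms by auto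
qed

text \<open>Each of the 18 vectors occurs in exactly two of the nine bases, so every weight is
  counted twice.\<close>

lemma even_sum_ks_bases:
  fixes h :: "quad \<Rightarrow> nat"
  shows "even (\<Sum>B\<leftarrow>ks_bases. \<Sum>x\<leftarrow>B. h x)"
proof -
  let ?xs = "concat ks_bases"
  have "\<forall>x\<in>set ?xs. count_list ?xs x = 2"
    by (simp add: ks_bases_def)
  hence "(\<Sum>x\<leftarrow>?xs. h x) = (\<Sum>x\<in>set ?xs. 2 * h x)"
    unfolding sum_list_map_eq_sum_count by (intro sum.cong) auto
  moreover have "(\<Sum>B\<leftarrow>Bs. \<Sum>x\<leftarrow>B. h x) = (\<Sum>x\<leftarrow>concat Bs. h x)" for Bs
    by (induction Bs) auto
  ultimately show ?thesis by (simp flip: sum_distrib_left)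
qed

text \<open>The number \<open>p\<close> stands for the colour of a fifth vector completing all nine
  bases. If it were 0, the bases would have total weight 9, contradicting evenness.\<close>

lemma ks_bases_odd_weight:
  fixes h :: "quad \<Rightarrow> nat"
  assumes "\<And>B. B \<in> set ks_bases \<Longrightarrow> p + (\<Sum>x\<leftarrow>B. h x) = 1"
  shows "p = 1"
proof (rule ccontr)
  assume "p \<noteq> 1"
  moreover have "p \<le> 1"
    using assms[of "hd ks_bases"] by (simp add: ks_bases_def)
  ultimately have "p = 0" by simp
  hence "(\<Sum>x\<leftarrow>B. h x) = 1" if "B \<in> set ks_bases" for B using assms[OF that] by simp
  hence "(\<Sum>B\<leftarrow>ks_bases. \<Sum>x\<leftarrow>B. h x) = (\<Sum>B\<leftarrow>ks_bases. 1)"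
    by (intro arg_cong[where f = sum_list] map_cong) simp_all
  thus False using even_sum_ks_bases[of h] by (simp add: ks_bases_def)
qed

section \<open>Copies of the Kochen--Specker set in hyperplanes of a five-dimensional space\<close>

definition real_vec5 :: "real \<Rightarrow> real \<Rightarrow> real \<Rightarrow> real \<Rightarrow> real \<Rightarrow> complex vec" where
  "real_vec5 a b c d e = vec 5 (\<lambda>i. complex_of_real ([a, b, c, d, e] ! i))"

text \<open>The vector \<open>pole \<theta>\<close> is the normal of the hyperplane that contains the image of
  \<open>emb \<theta>\<close>.\<close>

fun emb :: "real \<Rightarrow> quad \<Rightarrow> complex vec" where
  "emb \<theta> (p, q, r, s) = real_vec5 p q r (s * cos \<theta>) (s * sin \<theta>)"

definition pole :: "real \<Rightarrow> complex vec" where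
  "pole \<theta> = real_vec5 0 0 0 (- sin \<theta>) (cos \<theta>)"

text \<open>The rotation affects only the contribution of this coordinate; vectors in which it
  vanishes are common to all copies.\<close>

definition last_coord :: "quad \<Rightarrow> int" where
  "last_coord x = snd (snd (snd x))"

lemma real_vec5_cscalar_prod:
  "real_vec5 a b c d e \<bullet>c real_vec5 a' b' c' d' e' =
    complex_of_real (a * a' + b * b' + c * c' + d * d' + e * e')"
proof -
  have "{0..<5} = {0, 1, 2, 3, 4 :: nat}" by auto
  thus ?thesis by (simp add: real_vec5_def scalar_prod_def)
qed

lemma real_vec5_carrier [simp]: "real_vec5 a b c d e \<in> carrier_vec 5"
  by (simp add: real_vec5_def)

lemma real_vec5_nth [simp]:
  "real_vec5 a b c d e $ 0 = a" "real_vec5 a b c d e $ 1 = b" "real_vec5 a b c d e $ 2 = c"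
  "real_vec5 a b c d e $ 3 = d" "real_vec5 a b c d e $ 4 = e"
  by (simp_all add: real_vec5_def)

lemma emb_carrier [simp]: "emb \<theta> x \<in> carrier_vec 5"
  by (cases x) simp

lemma pole_carrier [simp]: "pole \<theta> \<in> carrier_vec 5"
  by (simp add: pole_def)

text \<open>The angles enter only through the product of the last coordinates. This form separates
  the integer \<open>dot x y\<close> from a correction that vanishes for equal angles.\<close>

lemma emb_emb:
  "emb \<theta> x \<bullet>c emb \<phi> y =
    complex_of_real (dot x y + last_coord x * last_coord y * (cos (\<theta> - \<phi>) - 1))"
  by (cases x; cases y)
    (simp add: real_vec5_cscalar_prod last_coord_def cos_diff algebra_simps
      del: of_real_add of_real_mult of_real_diff)

lemma pole_emb: "pole \<theta> \<bullet>c emb \<phi> y = complex_of_real (last_coord y * sin (\<phi> - \<theta>))"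
  by (cases y) (simp add: pole_def real_vec5_cscalar_prod last_coord_def sin_diff algebra_simps
      del: of_real_add of_real_mult of_real_diff)

lemma emb_pole: "emb \<phi> y \<bullet>c pole \<theta> = complex_of_real (last_coord y * sin (\<phi> - \<theta>))"
  using cscalar_prod_swap[of "pole \<theta>" 5 "emb \<phi> y"] by (simp add: pole_emb)

lemma pole_pole: "pole \<theta> \<bullet>c pole \<phi> = complex_of_real (cos (\<theta> - \<phi>))"
  by (simp add: pole_def real_vec5_cscalar_prod cos_diff algebra_simps
      del: of_real_add of_real_mult of_real_diff)

lemma pole_nonzero: "pole \<theta> \<noteq> 0\<^sub>v 5"
proof
  assume "pole \<theta> = 0\<^sub>v 5"
  hence "pole \<theta> \<bullet>c pole \<theta> = 0" by simp
  thus False unfolding pole_pole by simp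
qed

lemma emb_nonzero:
  assumes "x \<noteq> (0, 0, 0, 0)"
  shows "emb \<theta> x \<noteq> 0\<^sub>v 5"
proof
  assume "emb \<theta> x = 0\<^sub>v 5"
  hence "emb \<theta> x \<bullet>c emb \<theta> x = 0" by simp
  hence "dot x x = 0" unfolding emb_emb by simp
  thus False using assms by (cases x) (auto simp: add_nonneg_eq_0_iff)
qed

lemma emb_last_coord_0: "last_coord x = 0 \<Longrightarrow> emb \<theta> x = emb \<phi> x"
  by (cases x) (simp add: last_coord_def)

lemma sin_neq_0_if_cos:
  assumes "0 < cos t" "cos t < (1::real)"
  shows "sin t \<noteq> 0"
proof
  assume "sin t = 0"
  hence "(cos t)\<^sup>2 = 1" using sin_cos_squared_add[of t] by simp
  thus False using assms by (simp add: power2_eq_1_iff)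
qed

text \<open>The correction has absolute value \<open>1 - cos (\<theta> - \<phi>)\<close>, strictly
  between 0 and 1, so it cannot cancel the integer \<open>dot x y\<close>.\<close>

lemma emb_emb_nonorthogonal:
  assumes "last_coord x \<in> {-1, 1}" "last_coord y \<in> {-1, 1}"
    and "0 < cos (\<theta> - \<phi>)" "cos (\<theta> - \<phi>) < 1"
  shows "emb \<theta> x \<bullet>c emb \<phi> y \<noteq> 0"
proof
  define e where "e = last_coord x * last_coord y"
  have e: "e = 1 \<or> e = -1" using assms(1,2) by (auto simp: e_def)
  assume "emb \<theta> x \<bullet>c emb \<phi> y = 0"
  hence eq: "real_of_int (dot x y) + e * (cos (\<theta> - \<phi>) - 1) = 0"
    unfolding emb_emb of_real_eq_0_iff e_def by simp
  hence "\<bar>real_of_int (dot x y)\<bar> < 1" "dot x y \<noteq> 0" using e assms(3,4) by auto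
  thus False by linarith
qed

text \<open>\<open>A\<close> may exceed the Kochen-Specker vectors, which leaves room for the
  vectors that will carry the prescribed colour 0.\<close>

locale rotated_copies =
  fixes \<Theta> :: "real set" and A :: "quad set"
  assumes \<Theta>: "finite \<Theta>" "\<Theta> \<noteq> {}"
    and A: "finite A" "(0, 0, 0, 0) \<notin> A" "ks_vectors \<subseteq> A"
begin

definition X :: "complex vec set" where
  "X = pole ` \<Theta> \<union> (\<Union>\<theta>\<in>\<Theta>. emb \<theta> ` A)"

sublocale vectors 5 X
proof
  show "finite X" using \<Theta> A by (simp add: X_def)
  show "x \<in> carrier_vec 5" if "x \<in> X" for x using that by (auto simp: X_def)
  show "x \<noteq> 0\<^sub>v 5" if "x \<in> X" for x
    using that
    proof (unfold X_def, elim UnE UN_E imageE)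
      show "x \<noteq> 0\<^sub>v 5" if "x = pole \<theta>" for \<theta> using that pole_nonzero by simp
      show "x \<noteq> 0\<^sub>v 5" if "x = emb \<theta> y" "y \<in> A" for \<theta> y using that A(2) emb_nonzero by metis
    qed
qed

lemma pole_mem: "\<theta> \<in> \<Theta> \<Longrightarrow> pole \<theta> \<in> X"
  and emb_mem: "\<theta> \<in> \<Theta> \<Longrightarrow> x \<in> A \<Longrightarrow> emb \<theta> x \<in> X"
  by (auto simp: X_def)

lemma copy_of_basis:
  assumes "\<theta> \<in> \<Theta>" "B \<in> set ks_bases"
  shows "sorted_wrt (\<lambda>x y. x \<bullet>c y = 0) (pole \<theta> # map (emb \<theta>) B)"
    "set (pole \<theta> # map (emb \<theta>) B) \<subseteq> X" "length (pole \<theta> # map (emb \<theta>) B) = 5"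
proof -
  show "sorted_wrt (\<lambda>x y. x \<bullet>c y = 0) (pole \<theta> # map (emb \<theta>) B)"
    using ks_bases_orthogonal(1)[OF assms(2)]
    by (simp add: sorted_wrt_map emb_emb pole_emb)
  show "set (pole \<theta> # map (emb \<theta>) B) \<subseteq> X"
    using assms A(3) by (auto simp: X_def ks_vectors_def)
  show "length (pole \<theta> # map (emb \<theta>) B) = 5"
    using ks_bases_orthogonal(2)[OF assms(2)] by simp
qed

lemma vector_set: "vector_set 5 S"
proof -
  obtain \<theta> where "\<theta> \<in> \<Theta>" using \<Theta> by blast
  moreover have "hd ks_bases \<in> set ks_bases" by (simp add: ks_bases_def)
  ultimately show ?thesis using vector_set_rays[OF copy_of_basis] by simp
qed

text \<open>The pole completes the copy of each of the nine bases to an orthogonal basis of the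
  whole space, so the parity argument applies with its colour as \<open>p\<close>.\<close>

lemma coloring_pole:
  assumes "zero_one_coloring S E f" "\<theta> \<in> \<Theta>"
  shows "f (ray (pole \<theta>)) = 1"
proof (rule ks_bases_odd_weight)
  fix B assume "B \<in> set ks_bases"
  note B = copy_of_basis[OF assms(2) this]
  show "f (ray (pole \<theta>)) + (\<Sum>x\<leftarrow>B. f (ray (emb \<theta> x))) = 1"
    using coloring_orthogonal_list(2)[OF assms(1) B(1,2) vector_set B(3)] by (simp add: comp_def)
qed

lemma coloring_copy:
  assumes "zero_one_coloring S E f" "\<theta> \<in> \<Theta>" "x \<in> A"
  shows "f (ray (emb \<theta> x)) = 0"
proof -
  have "(\<Sum>v\<leftarrow>[pole \<theta>, emb \<theta> x]. f (ray v)) \<le> 1"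
    by (rule coloring_orthogonal_list(1)[OF assms(1)])
      (use assms(2,3) pole_mem emb_mem in \<open>auto simp: pole_emb\<close>)
  thus ?thesis using coloring_pole[OF assms(1,2)] by simp
qed

text \<open>A clique without a pole lies in the hyperplane of a single copy, so it is smaller than a
  basis.\<close>

lemma clique_meets_poles:
  assumes last: "\<And>x. x \<in> A \<Longrightarrow> last_coord x \<in> {-1, 0, 1}"
    and sep: "\<And>\<theta> \<phi>. \<theta> \<in> \<Theta> \<Longrightarrow> \<phi> \<in> \<Theta> \<Longrightarrow> \<theta> \<noteq> \<phi> \<Longrightarrow> 0 < cos (\<theta> - \<phi>) \<and> cos (\<theta> - \<phi>) < 1"
    and C: "clique S E C" "card C = 5"
  shows "\<exists>\<theta>\<in>\<Theta>. ray (pole \<theta>) \<in> C"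
proof (rule ccontr)
  assume no_pole: "\<not> ?thesis"
  have CS: "C \<subseteq> S" using C(1) by (simp add: clique_iff)
  have elem: "\<exists>\<phi>\<in>\<Theta>. \<exists>y\<in>A. u = ray (emb \<phi> y)" if "u \<in> C" for u
  proof -
    obtain x where "x \<in> X" "u = ray x" using \<open>u \<in> C\<close> CS by blast
    moreover have "x \<notin> pole ` \<Theta>" using \<open>u = ray x\<close> \<open>u \<in> C\<close> no_pole by fast
    ultimately show ?thesis unfolding X_def by fast
  qed
  \<comment> \<open>A member with nonzero last coordinate fixes the copy: any member orthogonal to
    it comes from the same angle or has last coordinate 0. If there is none, all members lie in
    every copy and any angle serves.\<close>
  have "\<exists>\<theta>\<in>\<Theta>. \<forall>u\<in>C. \<exists>y\<in>A. u = ray (emb \<theta> y)"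
  proof (cases "\<exists>\<theta>\<in>\<Theta>. \<exists>x\<in>A. ray (emb \<theta> x) \<in> C \<and> last_coord x \<noteq> 0")
    case True
    then obtain \<theta> x where x: "\<theta> \<in> \<Theta>" "x \<in> A" "ray (emb \<theta> x) \<in> C" "last_coord x \<noteq> 0" by blast
    have "\<forall>u\<in>C. \<exists>y\<in>A. u = ray (emb \<theta> y)"
    proof
      fix u assume u: "u \<in> C"
      obtain \<phi> y where y: "\<phi> \<in> \<Theta>" "y \<in> A" "u = ray (emb \<phi> y)" using elem[OF u] by blast
      have "u = ray (emb \<theta> x) \<or> ray (emb \<theta> x) \<bullet>c u = 0"
        using C(1) x(3) u by (auto simp: clique_iff)
      hence "u = ray (emb \<theta> x) \<or> emb \<theta> x \<bullet>c emb \<phi> y = 0"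
        using orthogonal_iff[OF emb_mem[OF x(1,2)] emb_mem[OF y(1,2)]] y(3) by simp
      moreover have "\<phi> = \<theta> \<or> last_coord y = 0" if "emb \<theta> x \<bullet>c emb \<phi> y = 0"
      proof (rule ccontr)
        assume *: "\<not> (\<phi> = \<theta> \<or> last_coord y = 0)"
        hence "last_coord x \<in> {-1, 1}" "last_coord y \<in> {-1, 1}"
          using last[OF x(2)] last[OF y(2)] x(4) by auto
        moreover have "0 < cos (\<theta> - \<phi>)" "cos (\<theta> - \<phi>) < 1" using sep[OF x(1) y(1)] * by auto
        ultimately show False using emb_emb_nonorthogonal[of x y \<theta> \<phi>] that by simp
      qed
      ultimately have "u = ray (emb \<theta> x) \<or> u = ray (emb \<theta> y)"
        using y(3) emb_last_coord_0[of y \<phi> \<theta>] by metis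
      thus "\<exists>y\<in>A. u = ray (emb \<theta> y)" using x(2) y(2) by blast
    qed
    thus ?thesis using x(1) by (rule bexI)
  next
    case False
    obtain \<theta> where \<theta>: "\<theta> \<in> \<Theta>" using \<Theta> by blast
    have "\<forall>u\<in>C. \<exists>y\<in>A. u = ray (emb \<theta> y)"
    proof
      fix u assume u: "u \<in> C"
      obtain \<phi> y where y: "\<phi> \<in> \<Theta>" "y \<in> A" "u = ray (emb \<phi> y)" using elem[OF u] by blast
      have "ray (emb \<phi> y) \<in> C" using u y(3) by simp
      hence "last_coord y = 0" using False y(1,2) by blast
      hence "u = ray (emb \<theta> y)" using y(3) emb_last_coord_0[of y \<phi> \<theta>] by simp
      thus "\<exists>y\<in>A. u = ray (emb \<theta> y)" using y(2) by blast
    qed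
    thus ?thesis using \<theta> by (rule bexI)
  qed
  then obtain \<theta> where \<theta>: "\<theta> \<in> \<Theta>" and copy: "\<forall>u\<in>C. \<exists>y\<in>A. u = ray (emb \<theta> y)" by blast
  let ?p = "ray (pole \<theta>)"
  have "?p \<bullet>c u = 0 \<and> u \<bullet>c ?p = 0" if u: "u \<in> C" for u
  proof -
    obtain y where y: "y \<in> A" "u = ray (emb \<theta> y)" using copy u by blast
    note mem = pole_mem[OF \<theta>] emb_mem[OF \<theta> y(1)]
    show ?thesis using y(2) orthogonal_iff[OF mem] orthogonal_iff[OF mem(2,1)]
      by (simp add: pole_emb emb_pole)
  qed
  \<comment> \<open>Adjoining the pole would give six pairwise orthogonal rays in dimension
    5.\<close>
  hence "clique S E (insert ?p C)"
    using C(1) imageI[OF pole_mem[OF \<theta>], of ray] by (simp add: clique_iff)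
  hence "card (insert ?p C) \<le> 5" by (rule clique_card_le)
  moreover have "?p \<notin> C" using no_pole \<theta> by blast
  ultimately show False using C(2) finite_clique[OF C(1)] by simp
qed

lemma colorable:
  assumes last: "\<And>x. x \<in> A \<Longrightarrow> last_coord x \<in> {-1, 0, 1}"
    and sep: "\<And>\<theta> \<phi>. \<theta> \<in> \<Theta> \<Longrightarrow> \<phi> \<in> \<Theta> \<Longrightarrow> \<theta> \<noteq> \<phi> \<Longrightarrow> 0 < cos (\<theta> - \<phi>) \<and> cos (\<theta> - \<phi>) < 1"
  shows "zero_one_colorable S E"
proof -
  define P where "P = ray ` pole ` \<Theta>"
  define f :: "complex vec \<Rightarrow> nat" where "f u = (if u \<in> P then 1 else 0)" for u
  \<comment> \<open>Positive cosines keep poles from being orthogonal, so a clique contains at most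
    one of them.\<close>
  have unique: "u = v" if *: "clique S E C" "u \<in> C" "v \<in> C" "u \<in> P" "v \<in> P" for C u v
  proof (rule ccontr)
    assume "u \<noteq> v"
    obtain \<theta> \<phi> where uv: "\<theta> \<in> \<Theta>" "\<phi> \<in> \<Theta>" "u = ray (pole \<theta>)" "v = ray (pole \<phi>)"
      using *(4,5) by (auto simp: P_def)
    have "u \<bullet>c v = 0" using *(1-3) \<open>u \<noteq> v\<close> by (simp add: clique_iff)
    hence "pole \<theta> \<bullet>c pole \<phi> = 0"
      using uv orthogonal_iff[OF pole_mem pole_mem, of \<theta> \<phi>] by simp
    thus False using sep[OF uv(1,2)] uv \<open>u \<noteq> v\<close> by (auto simp: pole_pole)
  qed
  have "(\<Sum>v\<in>C. f v) \<le> 1" if C: "clique S E C" for C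
  proof -
    have "(\<Sum>v\<in>C. f v) = card (C \<inter> P)"
      using finite_clique[OF C] by (simp add: f_def sum.If_cases)
    also have "\<dots> \<le> 1"
      using unique[OF C] finite_clique[OF C] by (auto simp: card_le_Suc0_iff_eq)
    finally show ?thesis .
  qed
  moreover have "\<exists>!v. v \<in> C \<and> f v = 1" if C: "clique S E C" "card C = clique_number S E" for C
  proof -
    have "card C = 5" using C vector_set by (simp add: vector_set_def)
    then obtain \<theta> where "\<theta> \<in> \<Theta>" "ray (pole \<theta>) \<in> C"
      using clique_meets_poles[OF last sep C(1)] by blast
    thus ?thesis using unique[OF C(1)] by (auto simp: f_def P_def)
  qed
  ultimately have "zero_one_coloring S E f" by (auto simp: zero_one_coloring_def f_def)
  thus ?thesis by (auto simp: zero_one_colorable_def)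
qed

end

section \<open>The constructions\<close>

lemma ks_vectors_props: "finite ks_vectors" "(0, 0, 0, 0) \<notin> ks_vectors"
    "x \<in> ks_vectors \<Longrightarrow> last_coord x \<in> {-1, 0, 1}"
proof -
  have "\<forall>x\<in>ks_vectors. last_coord x \<in> {-1, 0, 1}"
    by (simp add: ks_vectors_def ks_bases_def last_coord_def)
  thus "x \<in> ks_vectors \<Longrightarrow> last_coord x \<in> {-1, 0, 1}" by blast
qed (simp_all add: ks_vectors_def ks_bases_def)

lemma KS_set_exists: "\<exists>S. KS_set 5 S"
proof -
  \<comment> \<open>At a right angle the two poles are orthogonal, yet each is forced to have colour
    1.\<close>
  interpret rotated_copies "{0, pi / 2}" ks_vectors
    by unfold_locales (use ks_vectors_props in auto)
  have "\<not> zero_one_coloring S E f" for f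
  proof
    assume f: "zero_one_coloring S E f"
    have "(\<Sum>x\<leftarrow>[pole 0, pole (pi / 2)]. f (ray x)) \<le> 1"
      by (rule coloring_orthogonal_list(1)[OF f]) (auto simp: pole_pole pole_mem)
    thus False using coloring_pole[OF f] by simp
  qed
  thus ?thesis using vector_set by (auto simp: KS_set_def zero_one_colorable_def)
qed

lemma gadget_exists:
  assumes b: "b \<in> bit_strings m" "b \<notin> H"
  shows "\<exists>S. gadget 5 m H S"
proof -
  \<comment> \<open>Distinct values in (0, 1], so differences stay below 1 < pi/2 in absolute value:
    their cosines lie strictly between 0 and 1 and their sines are nonzero.\<close>
  define angle :: "nat \<Rightarrow> real" where "angle i = 1 / (real i + 2)" for i
  \<comment> \<open>The final entry 1 keeps these vectors out of the hyperplanes of the other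
    copies; the first entries make them pairwise non-proportional with positive inner
    products.\<close>
  define zero_quad :: "nat \<Rightarrow> quad" where "zero_quad j = (int j + 1, 0, 0, 1)" for j
  define A where "A = ks_vectors \<union> zero_quad ` {..<m}"
  have angle_inj: "angle i = angle j \<longleftrightarrow> i = j" for i j
    by (simp add: angle_def)
  have sep: "0 < cos (angle i - angle j) \<and> cos (angle i - angle j) < 1 \<and>
      sin (angle i - angle j) \<noteq> 0" if "i \<noteq> j" for i j
  proof -
    define t where "t = angle i - angle j"
    have "angle k > 0" "angle k \<le> 1" for k by (simp_all add: angle_def)
    from this[of i] this[of j] have t: "\<bar>t\<bar> < 1" by (simp add: t_def)
    have "t \<noteq> 0" using that angle_inj by (simp add: t_def)
    have "0 < cos \<bar>t\<bar>" using t pi_ge_two by (intro cos_gt_zero_pi) auto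
    moreover have "cos \<bar>t\<bar> < cos 0"
      using t pi_ge_two \<open>t \<noteq> 0\<close> by (intro cos_monotone_0_pi) auto
    ultimately show ?thesis using sin_neq_0_if_cos[of t] by (auto simp: t_def)
  qed
  have zero_quad_last: "last_coord (zero_quad j) = 1" for j
    by (simp add: zero_quad_def last_coord_def)
  have last: "last_coord x \<in> {-1, 0, 1}" if "x \<in> A" for x
    using that ks_vectors_props(3)[of x] zero_quad_last unfolding A_def by auto
  \<comment> \<open>\<open>angle 0\<close> is reserved for the positions with bit 0, and position
    \<open>j\<close> with bit 1 uses \<open>angle (Suc j)\<close>; hence indices up to
    \<open>m\<close> inclusive.\<close>
  interpret rotated_copies "angle ` {..m}" A
    by unfold_locales (use ks_vectors_props in \<open>auto simp: A_def zero_quad_def\<close>)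
  define w where "w j = (if b ! j = 1 then pole (angle (Suc j)) else emb (angle 0) (zero_quad j))" for j
  have wX: "w j \<in> X" if "j < m" for j
  proof -
    have "zero_quad j \<in> A" using that by (simp add: A_def)
    thus ?thesis
      using that pole_mem[of "angle (Suc j)"] emb_mem[of "angle 0" "zero_quad j"] by (simp add: w_def)
  qed
  \<comment> \<open>Two poles are settled by a cosine and a mixed pair by a sine. Two embedded
    vectors share \<open>angle 0\<close>, so their inner product is just \<open>dot\<close>.\<close>
  have nonorth: "w i \<bullet>c w j \<noteq> 0" if "i \<noteq> j" for i j
  proof -
    have "dot (zero_quad i) (zero_quad j) = (int i + 1) * (int j + 1) + 1"
      by (simp add: zero_quad_def)
    moreover have "(int i + 1) * (int j + 1) \<ge> 0" by simp
    ultimately have "dot (zero_quad i) (zero_quad j) \<noteq> 0" by linarith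
    moreover have "cos (angle (Suc i) - angle (Suc j)) \<noteq> 0"
      using sep[of "Suc i" "Suc j"] that by simp
    moreover have "sin (angle 0 - angle (Suc k)) \<noteq> 0" for k using sep[of 0 "Suc k"] by simp
    ultimately show ?thesis
      by (simp add: w_def pole_pole pole_emb emb_pole emb_emb zero_quad_last)
  qed
  have distinct: "i = j" if ij: "i < m" "j < m" and eq: "ray (w i) = ray (w j)" for i j
  proof (rule ccontr)
    assume "i \<noteq> j"
    \<comment> \<open>A member of \<open>X\<close> orthogonal to exactly one of the two vectors
      therefore separates their rays.\<close>
    have same_orth: "w i \<bullet>c z = 0 \<longleftrightarrow> w j \<bullet>c z = 0" if "z \<in> X" for z
      using orthogonal_iff[OF wX[OF ij(1)] that] orthogonal_iff[OF wX[OF ij(2)] that] eq by simp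
    \<comment> \<open>This pole is orthogonal to every vector chosen for a bit 0 and, by
      \<open>cos0\<close>, to none chosen for a bit 1.\<close>
    have z0: "pole (angle 0) \<in> X" by (rule pole_mem) simp
    have cos0: "cos (angle (Suc k) - angle 0) \<noteq> 0" for k using sep[of "Suc k" 0] by simp
    consider "b ! i = 1" "b ! j = 1" | "b ! i = 1 \<longleftrightarrow> b ! j \<noteq> 1" | "b ! i \<noteq> 1" "b ! j \<noteq> 1"
      by blast
    thus False
    proof cases
      case 1
      \<comment> \<open>This vector lies in the hyperplane of the pole for \<open>i\<close> but not
        in that of the pole for \<open>j\<close>.\<close>
      have z: "emb (angle (Suc i)) (zero_quad i) \<in> X"
        using ij A_def by (intro emb_mem) simp_all
      have "sin (angle (Suc i) - angle (Suc j)) \<noteq> 0"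
        using sep[of "Suc i" "Suc j"] \<open>i \<noteq> j\<close> by simp
      thus False using same_orth[OF z] 1 by (simp add: w_def pole_emb zero_quad_last)
    next
      case 2
      thus False
        using same_orth[OF z0] cos0[of i] cos0[of j]
        by (cases "b ! i = 1") (simp_all add: w_def pole_pole emb_pole)
    next
      case 3
      \<comment> \<open>Coordinate 0 recovers the index and coordinate 3 is the common nonzero
        \<open>cos (angle 0)\<close>, so this minor forces \<open>i = j\<close>.\<close>
      have "w i $ 0 * w j $ 3 = w i $ 3 * w j $ 0"
        by (rule ray_eqD[OF car nonzero car nonzero eq]) (use wX ij in simp_all)
      hence "complex_of_real ((real i + 1) * cos (angle 0))
          = complex_of_real ((real j + 1) * cos (angle 0))"
        using 3 by (simp add: w_def zero_quad_def mult.commute)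
      moreover have "cos (angle 0) > 0"
        using pi_ge_two by (intro cos_gt_zero_pi) (simp_all add: angle_def)
      ultimately show False using \<open>i \<noteq> j\<close> unfolding of_real_eq_iff by simp
    qed
  qed
  define I where "I = map (\<lambda>j. ray (w j)) [0..<m]"
  have "zero_one_colorable S E"
  proof (rule colorable[OF last])
    fix \<theta> \<phi> assume "\<theta> \<in> angle ` {..m}" "\<phi> \<in> angle ` {..m}" "\<theta> \<noteq> \<phi>"
    then obtain i j where "\<theta> = angle i" "\<phi> = angle j" "i \<noteq> j" by blast
    thus "0 < cos (\<theta> - \<phi>) \<and> cos (\<theta> - \<phi>) < 1" using sep[of i j] by simp
  qed
  moreover have "length I = m" "set I \<subseteq> S" using wX by (auto simp: I_def)
  moreover have "distinct I" using distinct by (auto simp: I_def distinct_map inj_on_def)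
  moreover have "u \<bullet>c v \<noteq> 0" if "u \<in> set I" "v \<in> set I" "u \<noteq> v" for u v
  proof -
    obtain i j where ij: "i < m" "j < m" "u = ray (w i)" "v = ray (w j)"
      using \<open>u \<in> set I\<close> \<open>v \<in> set I\<close> by (auto simp: I_def)
    hence "w i \<bullet>c w j \<noteq> 0" using nonorth[of i j] \<open>u \<noteq> v\<close> by blast
    thus ?thesis using ij orthogonal_iff[OF wX[OF ij(1)] wX[OF ij(2)]] by simp
  qed
  moreover have "map f I \<in> bit_strings m - H" if f: "zero_one_coloring S E f" for f
  proof -
    have "f (ray (w j)) = b ! j" if j: "j < m" for j
    proof -
      have "b ! j \<in> {0, 1}"
        using b(1) j nth_mem[of j b] unfolding bit_strings_def by blast
      show ?thesis
      proof (cases "b ! j = 1")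
        case True
        thus ?thesis using j coloring_pole[OF f, of "angle (Suc j)"] by (simp add: w_def)
      next
        case False
        moreover have "zero_quad j \<in> A" using j by (simp add: A_def)
        ultimately show ?thesis
          using coloring_copy[OF f, of "angle 0" "zero_quad j"] \<open>b ! j \<in> {0, 1}\<close>
          by (simp add: w_def)
      qed
    qed
    hence "map f I = b" using b(1) by (intro nth_equalityI) (simp_all add: I_def bit_strings_def)
    thus ?thesis using b by simp
  qed
  ultimately show ?thesis using vector_set unfolding gadget_def by blast
qed

section \<open>Counting the forbidden sets and combining the two constructions\<close>

lemma bit_strings_finite_card: "finite (bit_strings m)" "card (bit_strings m) = 2 ^ m"
proof -
  have eq: "bit_strings m = {b. set b \<subseteq> {0, 1} \<and> length b = m}"
    by (auto simp: bit_strings_def)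
  show "finite (bit_strings m)" unfolding eq by (rule finite_lists_length_eq) simp
  show "card (bit_strings m) = 2 ^ m" unfolding eq by (subst card_lists_length_eq) (auto simp: numeral_2_eq_2)
qed

theorem mainTheorem6:
  fixes m :: nat
  assumes "m \<ge> 2"
  shows "card {H. H \<subseteq> bit_strings m \<and> H \<noteq> {}} = 2 ^ (2 ^ m) - 1 \<and>
         (\<forall>H. H \<subseteq> bit_strings m \<and> H \<noteq> {} \<longrightarrow> (\<exists>d S. generalised_gadget d m H S))"
proof (intro conjI allI impI)
  have "{H. H \<subseteq> bit_strings m \<and> H \<noteq> {}} = Pow (bit_strings m) - {{}}" by auto
  thus "card {H. H \<subseteq> bit_strings m \<and> H \<noteq> {}} = 2 ^ (2 ^ m) - 1"
    using bit_strings_finite_card[of m] by (simp add: card_Pow)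
next
  fix H assume "H \<subseteq> bit_strings m \<and> H \<noteq> {}"
  show "\<exists>d S. generalised_gadget d m H S"
  proof (cases "H = bit_strings m")
    case True
    thus ?thesis using KS_set_exists by (auto simp: generalised_gadget_def)
  next
    case False
    then obtain b where "b \<in> bit_strings m" "b \<notin> H"
      using \<open>H \<subseteq> bit_strings m \<and> H \<noteq> {}\<close> by blast
    then obtain S where "gadget 5 m H S" using gadget_exists by blast
    hence "generalised_gadget 5 m H S" using False by (simp add: generalised_gadget_def)
    thus ?thesis by blast
  qed
qed

end
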